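(* Let $p=3$ and let $k\ge 2$ be an integer; consider the circle with identifications, the energy $\mathcal{E}$, and the Laplacian $\Delta$ described in the context, with $P(t)=3t \bmod 1$. Let $u$ be an eigenfunction of $-\Delta$. Then $u$ is of the form $v\circ P$ for an eigenfunction $v$ of $-\Delta$ if and only if $$u\left(t+\tfrac13\right)=u(t)\quad\text{for all } t .$$ As a consequence, a primitive eigenspace (the eigenspace of a primitive eigenvalue), decomposed as a representation of the dihedral-3 symmetry group $G$, cannot contain any components corresponding to one-dimensional representations of $G$.
   Context: The circle is $\mathbb{R}/\mathbb{Z}$. Put $\theta=\frac{1}{3(3^k-1)}$ and divide the circle into the arcs $A_n=(\theta+\frac n3,\theta+\frac{n+1}{3}]$ (mod 1), $n=0,1,2$. The kneading sequence of $t$ is $(n_0,n_1,\dots)$ where $3^jt \bmod 1\in A_{n_j}$. Two points of the circle are identified if and only if they have the same kneading sequence; the quotient $\mathcal{J}$ is the model of a Julia set of a cubic polynomial $z^3+c$. Functions on $\mathcal{J}$ are functions on the circle taking equal values at identified points ("respecting identifications"). For $m\ge1$, the points of $X^{(m)}$ are the points $\frac{3^n+\ell(3^k-1)}{3^m(3^k-1)} \bmod 1$, $1\le n\le k$, $0\le\ell\le 3^m-1$, and identified points represent the same vertex; the edges are the closed arcs $[x,y]$ between neighbouring points, and an edge is of type $n$ ($0\le n\le k-1$) if its length $|x-y|$ is $\frac{2\cdot 3^n}{3^m(3^k-1)}$. Let $r=3^{\frac{k-1}{k}}$ and $$\mathcal{E}^{(m)}(u)=r^{-m}\sum_{n=0}^{k-1}r^{n}\sum_{[x,y]\text{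 of type }n}\frac{|u(x)-u(y)|^2}{|x-y|},\qquad \mathcal{E}(u)=\lim_{m\to\infty}\mathcal{E}^{(m)}(u)\in[0,\infty]$$ for continuous $u$ respecting identifications (the sequence $\mathcal{E}^{(m)}(u)$ is nondecreasing in $m$). $\mathrm{dom}(\mathcal{E})$ is the set of such $u$ with $\mathcal{E}(u)<\infty$, and $\mathcal{E}(u,v)$ denotes the bilinear form obtained by polarization. $\mu$ is Lebesgue measure on the circle. The Laplacian is defined by $\mathcal{E}(u,v)=-\int(\Delta u)v\,d\mu$ for all $v\in\mathrm{dom}(\mathcal{E})$; thus an eigenfunction of $-\Delta$ with eigenvalue $\lambda$ is a nonzero $u\in\mathrm{dom}(\mathcal{E})$ with $\mathcal{E}(u,v)=\lambda\int uv\,d\mu$ for all $v\in\mathrm{dom}(\mathcal{E})$. If $v$ is an eigenfunction with eigenvalue $\lambda$ then $v\circ P$ is an eigenfunction with eigenvalue $3^{\frac{k+1}{k}}\lambda$. A nonzero eigenvalue is called primitive if it is not of the form $3^{\frac{k+1}{k}}\lambda'$ for an eigenvalue $\lambda'$. $G$ denotes a group of symmetries of $\mathcal{J}$ (homeomorphisms of $\mathcal{J}$ preserving $\mathcal{E}$ and $\mu$) isomorphic to the dihedral group of order 6, whose subgroup of order 3 is generated by the rotation $t\mapsto t+\frac13$, the other generators being "reflections", each fixing one of the three vertices of $X^{(1)}$ and interchanging the other two. $G$ acts on functions by composition and hence on each eigenspace. *)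

theory Defs
  imports
    "HOL-Analysis.Analysis"
    "HOL-Library.Function_Algebras"
    "HOL-Algebra.Bij"
    "HOL-Algebra.Generated_Groups"
begin

text \<open>
  The circle is \<open>\<real>/\<int>\<close>.  Subsets of the circle are represented by their \<open>\<int>\<close>-periodic lifts to
  \<open>\<real>\<close>, and functions on the circle by \<open>1\<close>-periodic functions on \<open>\<real>\<close>.
\<close>

definition theta :: "nat \<Rightarrow> real" where
  "theta k = 1 / (3 * (3 ^ k - 1))"

definition kneading_arc :: "nat \<Rightarrow> nat \<Rightarrow> real set" where
  "kneading_arc k n = {t. \<exists>z::int. t + of_int z \<in> {theta k + real n / 3 <.. theta k + (real n + 1) / 3}}"

text \<open>The three arcs partition the circle, so the description below is always proper.\<close>

definition kneading :: "nat \<Rightarrow> real \<Rightarrow> nat \<Rightarrow> nat" where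
  "kneading k t = (\<lambda>j. THE n. n < 3 \<and> 3 ^ j * t \<in> kneading_arc k n)"

lemma kneading_arc_add_int: "t + of_int w \<in> kneading_arc k n \<longleftrightarrow> t \<in> kneading_arc k n"
proof
  assume "t + of_int w \<in> kneading_arc k n"
  then obtain z :: int where
    z: "t + of_int w + of_int z \<in> {theta k + real n / 3 <.. theta k + (real n + 1) / 3}"
    unfolding kneading_arc_def by blast
  have "t + of_int (w + z) = t + of_int w + of_int z"
    by simp
  with z show "t \<in> kneading_arc k n"
    unfolding kneading_arc_def by (metis (mono_tags, lifting) mem_Collect_eq)
next
  assume "t \<in> kneading_arc k n"
  then obtain z :: int where
    z: "t + of_int z \<in> {theta k + real n / 3 <.. theta k + (real n + 1) / 3}"
    unfolding kneading_arc_def by blast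
  have "t + of_int w + of_int (z - w) = t + of_int z"
    by simp
  with z show "t + of_int w \<in> kneading_arc k n"
    unfolding kneading_arc_def by (metis (mono_tags, lifting) mem_Collect_eq)
qed

lemma kneading_plus_1: "kneading k (t + 1) = kneading k t"
proof -
  have "3 ^ j * (t + 1) = 3 ^ j * t + of_int (3 ^ j)" for j
    by (simp add: distrib_left)
  then show ?thesis
    by (simp only: kneading_def kneading_arc_add_int)
qed


text \<open>
  Continuous functions on the circle that respect identifications.  Periodicity is not a separate
  requirement, because \<open>t\<close> and \<open>t + 1\<close> have the same kneading sequence.
\<close>

definition respects_identifications :: "nat \<Rightarrow> (real \<Rightarrow> real) \<Rightarrow> bool" where
  "respects_identifications k u \<longleftrightarrow> (\<forall>s t. kneading k s = kneading k t \<longrightarrow> u s = u t)"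

lemma respects_identifications_periodic:
  "respects_identifications k u \<Longrightarrow> u (t + 1) = u t"
  unfolding respects_identifications_def using kneading_plus_1 by blast

definition julia_functions :: "nat \<Rightarrow> (real \<Rightarrow> real) set" where
  "julia_functions k = {u. continuous_on UNIV u \<and> respects_identifications k u}"


definition X_points :: "nat \<Rightarrow> nat \<Rightarrow> real set" where
  "X_points k m = {(3 ^ n + real l * (3 ^ k - 1)) / (3 ^ m * (3 ^ k - 1)) + of_int z | n l (z::int).
              1 \<le> n \<and> n \<le> k \<and> l \<le> 3 ^ m - 1}"

text \<open>
  An edge of the circle has exactly one lift \<open>[x, y]\<close> to \<open>\<real>\<close> with \<open>x \<in> [0, 1)\<close>; its length is
  \<open>y - x\<close>.
\<close>

definition edges :: "nat \<Rightarrow> nat \<Rightarrow> (real \<times> real) set" where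
  "edges k m = {(x, y). x \<in> X_points k m \<and> y \<in> X_points k m \<and> 0 \<le> x \<and> x < 1 \<and> x < y \<and> X_points k m \<inter> {x<..<y} = {}}"

definition edges_of_type :: "nat \<Rightarrow> nat \<Rightarrow> nat \<Rightarrow> (real \<times> real) set" where
  "edges_of_type k m n =
     {(x, y) \<in> edges k m. \<bar>x - y\<bar> = 2 * 3 ^ n / (3 ^ m * (3 ^ k - 1))}"

definition ratio :: "nat \<Rightarrow> real" where
  "ratio k = 3 powr ((real k - 1) / real k)"

definition level_energy :: "nat \<Rightarrow> nat \<Rightarrow> (real \<Rightarrow> real) \<Rightarrow> real" where
  "level_energy k m u =
     (1 / ratio k ^ m) *
       (\<Sum>n<k. ratio k ^ n * (\<Sum>(x, y)\<in>edges_of_type k m n. \<bar>u x - u y\<bar>\<^sup>2 / \<bar>x - y\<bar>))"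

definition energy :: "nat \<Rightarrow> (real \<Rightarrow> real) \<Rightarrow> ennreal" where
  "energy k u = lim (\<lambda>m. ennreal (level_energy k m u))"

definition dom_energy :: "nat \<Rightarrow> (real \<Rightarrow> real) set" where
  "dom_energy k = {u \<in> julia_functions k. energy k u < \<infinity>}"

definition energy_form :: "nat \<Rightarrow> (real \<Rightarrow> real) \<Rightarrow> (real \<Rightarrow> real) \<Rightarrow> real" where
  "energy_form k u v =
     (enn2real (energy k (\<lambda>t. u t + v t)) - enn2real (energy k (\<lambda>t. u t - v t))) / 4"


text \<open>
  Weak form of \<open>-\<Delta>u = lam u\<close>, where \<open>\<Delta>\<close> is given by \<open>\<E>(u,v) = -\<integral>(\<Delta>u)v d\<mu>\<close> for all \<open>v \<in> dom \<E>\<close> and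
  \<open>\<mu>\<close> is Lebesgue measure on the fundamental domain \<open>[0, 1)\<close>.
\<close>

definition eigenspace :: "nat \<Rightarrow> real \<Rightarrow> (real \<Rightarrow> real) set" where
  "eigenspace k lam =
     {u \<in> dom_energy k. \<forall>v\<in>dom_energy k.
        energy_form k u v = lam * (LINT t:{0..<1}|lborel. u t * v t)}"

definition eigenfunction :: "nat \<Rightarrow> real \<Rightarrow> (real \<Rightarrow> real) \<Rightarrow> bool" where
  "eigenfunction k lam u \<longleftrightarrow> u \<in> eigenspace k lam \<and> u \<noteq> (\<lambda>t. 0)"

definition eigenvalue :: "nat \<Rightarrow> real \<Rightarrow> bool" where
  "eigenvalue k lam \<longleftrightarrow> (\<exists>u. eigenfunction k lam u)"

definition primitive_eigenvalue :: "nat \<Rightarrow> real \<Rightarrow> bool" where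
  "primitive_eigenvalue k lam \<longleftrightarrow>
     eigenvalue k lam \<and> lam \<noteq> 0 \<and>
     \<not> (\<exists>lam'. eigenvalue k lam' \<and> lam = 3 powr ((real k + 1) / real k) * lam')"

definition P_map :: "real \<Rightarrow> real" where
  "P_map t = frac (3 * t)"


text \<open>
  The space \<open>\<J>\<close>: the quotient of \<open>\<real>\<close>, hence of \<open>\<real>/\<int>\<close>, by equality of kneading sequences.  Its
  points are the equivalence classes, with the quotient topology and the image of Lebesgue measure.
\<close>

definition julia :: "nat \<Rightarrow> real set set" where
  "julia k = UNIV // {(s, t). kneading k s = kneading k t}"

definition julia_point :: "nat \<Rightarrow> real \<Rightarrow> real set" where
  "julia_point k t = {s. kneading k t = kneading k s}"

lemma julia_eq_range: "julia k = range (julia_point k)"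
  by (auto simp: julia_def julia_point_def quotient_def)

definition julia_topology :: "nat \<Rightarrow> real set topology" where
  "julia_topology k = topology (\<lambda>U. U \<subseteq> julia k \<and> open {t. julia_point k t \<in> U})"

lemma openin_julia_topology:
  "openin (julia_topology k) U \<longleftrightarrow> U \<subseteq> julia k \<and> open {t. julia_point k t \<in> U}"
proof -
  have "istopology (\<lambda>U. U \<subseteq> julia k \<and> open {t. julia_point k t \<in> U})"
    unfolding istopology_def
  proof (intro conjI allI impI)
    fix S T assume "S \<subseteq> julia k \<and> open {t. julia_point k t \<in> S}"
      and "T \<subseteq> julia k \<and> open {t. julia_point k t \<in> T}"
    then show "S \<inter> T \<subseteq> julia k" and "open {t. julia_point k t \<in> S \<inter> T}"
      by (auto simp: Collect_conj_eq)
  next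
    fix \<K> assume *: "\<forall>K\<in>\<K>. K \<subseteq> julia k \<and> open {t. julia_point k t \<in> K}"
    then show "\<Union>\<K> \<subseteq> julia k"
      by blast
    have "{t. julia_point k t \<in> \<Union>\<K>} = (\<Union>K\<in>\<K>. {t. julia_point k t \<in> K})"
      by blast
    with * show "open {t. julia_point k t \<in> \<Union>\<K>}"
      by auto
  qed
  then show ?thesis
    by (simp add: julia_topology_def)
qed

lemma topspace_julia_topology: "topspace (julia_topology k) = julia k"
proof -
  have "{t. julia_point k t \<in> julia k} = UNIV"
    by (auto simp: julia_eq_range)
  then have "openin (julia_topology k) (julia k)"
    by (simp add: openin_julia_topology)
  then show ?thesis
    by (metis openin_julia_topology openin_subset openin_topspace subset_antisym)
qed

lemma quotient_map_julia_point: "quotient_map euclideanreal (julia_topology k) (julia_point k)"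
proof -
  have "openin euclideanreal {t \<in> topspace euclideanreal. julia_point k t \<in> U} = openin (julia_topology k) U"
    if "U \<subseteq> topspace (julia_topology k)" for U
  proof -
    have "{t \<in> topspace euclideanreal. julia_point k t \<in> U} = {t. julia_point k t \<in> U}"
      by simp
    then show ?thesis
      using that by (metis open_openin openin_julia_topology topspace_julia_topology)
  qed
  moreover have "julia_point k ` topspace euclideanreal = topspace (julia_topology k)"
    by (simp only: topspace_julia_topology julia_eq_range topspace_euclidean)
  ultimately show ?thesis
    unfolding quotient_map_def by blast
qed

definition julia_measure :: "nat \<Rightarrow> real set measure" where
  "julia_measure k =
     distr (restrict_space lborel {0..<1})
       (sigma (julia k) {U. openin (julia_topology k) U}) (julia_point k)"


text \<open>
  The function \<open>u \<circ> g\<close> on \<open>\<J>\<close>, again read as a function on the circle: its value at \<open>t\<close> is the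
  common value of \<open>u\<close> on the class \<open>g [t]\<close>.
\<close>

definition compose_julia :: "nat \<Rightarrow> (real \<Rightarrow> real) \<Rightarrow> (real set \<Rightarrow> real set) \<Rightarrow> real \<Rightarrow> real" where
  "compose_julia k u g = (\<lambda>t. the_elem (u ` g (julia_point k t)))"

definition julia_symmetry :: "nat \<Rightarrow> (real set \<Rightarrow> real set) \<Rightarrow> bool" where
  "julia_symmetry k g \<longleftrightarrow>
     homeomorphic_map (julia_topology k) (julia_topology k) g \<and>
     (\<forall>u\<in>julia_functions k. energy k (compose_julia k u g) = energy k u) \<and>
     (\<forall>A\<in>sets (julia_measure k).
        emeasure (julia_measure k) (g -` A \<inter> julia k) = emeasure (julia_measure k) A)"

definition julia_rotation :: "nat \<Rightarrow> real set \<Rightarrow> real set" where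
  "julia_rotation k = (\<lambda>c\<in>julia k. (\<lambda>t. t + 1/3) ` c)"

text \<open>
  Dihedral group of order \<open>2n\<close>: \<open>(i, a)\<close> stands for \<open>\<rho>\<^sup>i \<sigma>\<^sup>a\<close> with \<open>\<rho>\<^sup>n = \<sigma>\<^sup>2 = 1\<close> and
  \<open>\<sigma> \<rho> \<sigma> = \<rho>\<^sup>-\<^sup>1\<close>.
\<close>

definition dihedral_group :: "nat \<Rightarrow> (int \<times> bool) monoid" where
  "dihedral_group n =
     \<lparr>carrier = {0..<int n} \<times> UNIV,
      mult = (\<lambda>(i, a) (j, b). ((if a then i - j else i + j) mod int n, a \<noteq> b)),
      one = (0, False)\<rparr>"

definition julia_vertices :: "nat \<Rightarrow> nat \<Rightarrow> real set set" where
  "julia_vertices k m = julia_point k ` X_points k m"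

definition julia_reflection :: "nat \<Rightarrow> (real set \<Rightarrow> real set) \<Rightarrow> bool" where
  "julia_reflection k g \<longleftrightarrow>
     (\<exists>a b c. julia_vertices k 1 = {a, b, c} \<and> a \<noteq> b \<and> a \<noteq> c \<and> b \<noteq> c \<and>
        g a = a \<and> g b = c \<and> g c = b)"

definition dihedral_symmetry_group :: "nat \<Rightarrow> (real set \<Rightarrow> real set) set \<Rightarrow> bool" where
  "dihedral_symmetry_group k G \<longleftrightarrow>
     subgroup G (BijGroup (julia k)) \<and>
     (\<forall>g\<in>G. julia_symmetry k g) \<and>
     (BijGroup (julia k))\<lparr>carrier := G\<rparr> \<cong> dihedral_group 3 \<and>
     julia_rotation k \<in> G \<and>
     card (generate (BijGroup (julia k)) {julia_rotation k}) = 3 \<and>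
     (\<forall>g \<in> G - generate (BijGroup (julia k)) {julia_rotation k}. julia_reflection k g)"


interpretation fun_space: vector_space "\<lambda>(c::real) (f::real \<Rightarrow> real) t. c * f t"
  by unfold_locales (auto simp: fun_eq_iff algebra_simps)

definition subrepresentation ::
  "nat \<Rightarrow> (real set \<Rightarrow> real set) set \<Rightarrow> (real \<Rightarrow> real) set \<Rightarrow> (real \<Rightarrow> real) set \<Rightarrow> bool" where
  "subrepresentation k G V W \<longleftrightarrow>
     fun_space.subspace W \<and> W \<subseteq> V \<and> (\<forall>g\<in>G. \<forall>u\<in>W. compose_julia k u g \<in> W)"

end

theory Submission
  imports Defs
begin

text \<open>
  Put \<open>a\<^sub>i = 3 ^ i / (3 ^ k - 1)\<close>.  A point \<open>t\<close> is a vertex of level \<open>m\<close> iff \<open>3 ^ m * t\<close> is some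
  \<open>a\<^sub>i\<close> modulo \<open>1\<close>, so the edges of level \<open>m + 1\<close> are the preimages under tripling of those of level
  \<open>m\<close>, and \<open>v \<circ> P\<close> has energy \<open>3 powr ((k + 1) / k)\<close> times that of \<open>v\<close> (the limit exists because the
  level energies increase: an edge of maximal type is subdivided into a chain in which only three edges
  join non-identified points).  Hence a \<open>1/3\<close>-periodic eigenfunction \<open>u\<close> descends to the eigenfunction
  \<open>t \<mapsto> u (t / 3)\<close>.  On a one-dimensional subrepresentation the rotation acts by a real \<open>c\<close> with
  \<open>c ^ 3 = 1\<close>, so \<open>c = 1\<close> and its elements are \<open>1/3\<close>-periodic, which primitivity excludes.
\<close>

section \<open>The period-\<open>k\<close> orbit of tripling and its lift to the line\<close>

definition cycle_point :: "nat \<Rightarrow> nat \<Rightarrow> real" where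
  "cycle_point k i = 3 ^ i / (3 ^ k - 1)"

lemma cycle_point_Suc: "cycle_point k (Suc i) = 3 * cycle_point k i"
  by (simp add: cycle_point_def)

lemma power_mult_cycle_point: "3 ^ j * cycle_point k i = cycle_point k (i + j)"
  by (simp add: cycle_point_def power_add)

lemma three_power_gt_1: "k \<ge> 1 \<Longrightarrow> (1::real) < 3 ^ k"
  by (rule one_less_power) auto

lemma cycle_point_pos: "k \<ge> 1 \<Longrightarrow> cycle_point k i > 0"
  using three_power_gt_1[of k] by (simp add: cycle_point_def)

lemma cycle_point_add:
  assumes "k \<ge> 1" shows "cycle_point k (k + i) = cycle_point k i + 3 ^ i"
proof -
  have "(3::real) ^ k - 1 \<noteq> 0" using three_power_gt_1[OF assms] by simp
  then show ?thesis by (simp add: cycle_point_def power_add field_simps)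
qed

lemma cycle_point_period: "k \<ge> 1 \<Longrightarrow> cycle_point k k = cycle_point k 0 + 1"
  using cycle_point_add[of k 0] by simp

lemma cycle_point_less_iff:
  assumes "k \<ge> 1" shows "cycle_point k i < cycle_point k j \<longleftrightarrow> i < j"
proof -
  have "(3::real) ^ k - 1 > 0" using three_power_gt_1[OF assms] by simp
  then show ?thesis by (simp add: cycle_point_def divide_less_cancel)
qed

lemma cycle_point_le_iff: "k \<ge> 1 \<Longrightarrow> cycle_point k i \<le> cycle_point k j \<longleftrightarrow> i \<le> j"
  using cycle_point_less_iff[of k j i] by linarith

lemma cycle_point_less_1:
  assumes "i < k" shows "cycle_point k i < 1"
proof -
  have "1 \<le> k" using assms by simp
  have "cycle_point k i \<le> cycle_point k (k - 1)"
    using assms by (subst cycle_point_le_iff) auto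
  moreover have "3 * cycle_point k (k - 1) = cycle_point k 0 + 1"
    using cycle_point_Suc[of k "k - 1"] cycle_point_period[OF \<open>1 \<le> k\<close>] assms by simp
  moreover have "cycle_point k 0 \<le> cycle_point k (k - 1)"
    using \<open>1 \<le> k\<close> by (subst cycle_point_le_iff) auto
  ultimately show ?thesis by linarith
qed

text \<open>Hence the end points \<open>theta k + n / 3\<close> of the kneading arcs are the three
  preimages of \<open>a_0\<close> under tripling, and every change of a symbol can be traced back to
  the orbit.\<close>

lemma theta_eq: "theta k = cycle_point k 0 / 3"
  by (simp add: theta_def cycle_point_def)

definition cycle_lift :: "nat \<Rightarrow> real set" where
  "cycle_lift k = {cycle_point k i + of_int z | i z. i < k}"

lemma cycle_point_in_lift: "k \<ge> 1 \<Longrightarrow> cycle_point k i + of_int z \<in> cycle_lift k"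
proof (induction i arbitrary: z rule: less_induct)
  case (less i)
  show ?case
  proof (cases "i < k")
    case True
    then show ?thesis by (auto simp: cycle_lift_def)
  next
    case False
    then obtain d where d: "i = k + d"
      by (metis le_add_diff_inverse not_less)
    have "cycle_point k i + of_int z = cycle_point k d + of_int (z + 3 ^ d)"
      using cycle_point_add[OF less.prems] d by simp
    moreover have "d < i" using d less.prems by simp
    ultimately show ?thesis using less by metis
  qed
qed

lemma power_mult_cycle_lift:
  assumes "k \<ge> 1" "x \<in> cycle_lift k" shows "3 ^ j * x \<in> cycle_lift k"
proof -
  obtain i z where x: "x = cycle_point k i + of_int z"
    using assms(2) by (auto simp: cycle_lift_def)
  have "3 ^ j * x = cycle_point k (i + j) + of_int (3 ^ j * z)"
    by (simp add: x distrib_left power_mult_cycle_point)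
  then show ?thesis using cycle_point_in_lift[OF assms(1)] by metis
qed

text \<open>Since \<open>a_0 < ... < a_(k-1) < 1\<close> and \<open>a_k = a_0 + 1\<close>, the orbit
  occurs on the circle in the order of its indices, and the last gap runs from
  \<open>a_(k-1)\<close> to the next copy of \<open>a_0\<close>.\<close>

lemma cycle_lift_gap:
  assumes "n < k" "x \<in> cycle_lift k"
    and "cycle_point k n + of_int z < x" "x < cycle_point k (Suc n) + of_int z"
  shows False
proof -
  have k: "1 \<le> k" using assms by simp
  obtain i w where x: "x = cycle_point k i + of_int w" "i < k"
    using assms(2) by (auto simp: cycle_lift_def)
  have i: "cycle_point k i < 1" "0 < cycle_point k i" "cycle_point k 0 \<le> cycle_point k i"
    and n: "0 < cycle_point k n" "cycle_point k (Suc n) \<le> cycle_point k 0 + 1"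
    using cycle_point_less_1[OF x(2)] cycle_point_pos[OF k] cycle_point_le_iff[OF k, of "Suc n" k]
      cycle_point_period[OF k] assms(1) by (auto simp: cycle_point_le_iff[OF k])
  consider "w < z" | "w = z" | "w > z" by linarith
  then show False
  proof cases
    case 1
    then have "real_of_int w \<le> real_of_int z - 1" by linarith
    then show False using assms(3) x i n by linarith
  next
    case 2
    then show False using assms(3,4) x cycle_point_less_iff[OF k] by auto
  next
    case 3
    then have "real_of_int w \<ge> real_of_int z + 1" by linarith
    then show False using assms(4) x i n by linarith
  qed
qed

section \<open>Vertices and edges of level \<open>m\<close>\<close>

lemma X_points_iff:
  assumes "k \<ge> 1"
  shows "t \<in> X_points k m \<longleftrightarrow> 3 ^ m * t \<in> cycle_lift k"
proof
  have k: "(3::real) ^ k - 1 \<noteq> 0" using three_power_gt_1[OF assms] by simp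
  assume "t \<in> X_points k m"
  then obtain n l z where
    t: "t = (3 ^ n + real l * (3 ^ k - 1)) / (3 ^ m * (3 ^ k - 1)) + of_int z"
    by (auto simp: X_points_def)
  have "M * ((a + b * D) / (M * D) + c) = a / D + (b + M * c)" if "M \<noteq> 0" "D \<noteq> 0" for M D a b c :: real
    using that by (simp add: field_simps)
  from this[of "3 ^ m" "3 ^ k - 1"] have "3 ^ m * t = cycle_point k n + of_int (int l + 3 ^ m * z)"
    using k by (simp add: t cycle_point_def)
  then show "3 ^ m * t \<in> cycle_lift k"
    using cycle_point_in_lift[OF assms] by metis
next
  have k: "(3::real) ^ k - 1 \<noteq> 0" using three_power_gt_1[OF assms] by simp
  assume "3 ^ m * t \<in> cycle_lift k"
  then obtain i z where iz: "3 ^ m * t = cycle_point k i + of_int z" "i < k"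
    by (auto simp: cycle_lift_def)
  obtain n w where n: "3 ^ m * t = cycle_point k n + of_int w" "1 \<le> n" "n \<le> k"
  proof (cases "i = 0")
    case True
    then have "3 ^ m * t = cycle_point k k + of_int (z - 1)"
      using iz cycle_point_period[OF assms] by simp
    then show ?thesis using that assms by blast
  next
    case False
    then show ?thesis using that[of i z] iz by simp
  qed
  \<comment> \<open>Only the residue of \<open>w\<close> modulo \<open>3 ^ m\<close> matters on the
    circle; the quotient becomes an integer translation of \<open>t\<close>.\<close>
  define l where "l = nat (w mod 3 ^ m)"
  have l: "l \<le> 3 ^ m - 1" "int l = w mod 3 ^ m"
  proof -
    have "w mod 3 ^ m < 3 ^ m" "0 \<le> w mod 3 ^ m" by auto
    then show "int l = w mod 3 ^ m" by (simp add: l_def)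
    with \<open>w mod 3 ^ m < 3 ^ m\<close> have "int l < int (3 ^ m)" by simp
    then show "l \<le> 3 ^ m - 1" by linarith
  qed
  have "w = int l + 3 ^ m * (w div 3 ^ m)"
    using l(2) by simp
  then have "real_of_int w = real_of_int (int l + 3 ^ m * (w div 3 ^ m))"
    by simp
  then have w: "real_of_int w = real l + 3 ^ m * of_int (w div 3 ^ m)"
    by simp
  have "t = (cycle_point k n + of_int w) / 3 ^ m"
    using n(1) by (simp add: field_simps)
  also have "\<dots> = (3 ^ n + real l * (3 ^ k - 1)) / (3 ^ m * (3 ^ k - 1)) + of_int (w div 3 ^ m)"
  proof -
    have "(a / D + (b + M * c)) / M = (a + b * D) / (M * D) + c" if "M \<noteq> 0" "D \<noteq> 0" for M D a b c :: real
      using that by (simp add: field_simps)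
    from this[of "3 ^ m" "3 ^ k - 1"] show ?thesis
      using k by (simp add: w cycle_point_def)
  qed
  finally show "t \<in> X_points k m"
    unfolding X_points_def using n(2,3) l(1) by blast
qed

text \<open>Edges are the gaps of the orbit, scaled down by \<open>3 ^ m\<close>. Gap
  \<open>n\<close> has length \<open>2 * a_n\<close> because \<open>a_(n+1) = 3 * a_n\<close>; these
  lengths are distinct, so the type of an edge is the index of its gap.\<close>

lemma edges_of_type_eq:
  assumes "n < k"
  shows "edges_of_type k m n =
    (\<lambda>j. ((cycle_point k n + real j) / 3 ^ m, (cycle_point k (Suc n) + real j) / 3 ^ m)) ` {..<3 ^ m}"
    (is "_ = ?f ` _")
proof
  have k: "1 \<le> k" using assms by simp
  note X = X_points_iff[OF k]
  show "?f ` {..<3 ^ m} \<subseteq> edges_of_type k m n"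
  proof clarify
    fix j :: nat assume "j < 3 ^ m"
    define x y where "x = (cycle_point k n + real j) / 3 ^ m"
      and "y = (cycle_point k (Suc n) + real j) / 3 ^ m"
    have xy: "3 ^ m * x = cycle_point k n + of_int (int j)"
      "3 ^ m * y = cycle_point k (Suc n) + of_int (int j)"
      by (simp_all add: x_def y_def)
    have "real j + 1 \<le> 3 ^ m"
      using \<open>j < 3 ^ m\<close> by (metis Suc_leI add.commute of_nat_Suc of_nat_le_iff of_nat_numeral of_nat_power)
    then have "0 \<le> x" "x < 1"
      using cycle_point_pos[OF k, of n] cycle_point_less_1[OF assms] by (auto simp: x_def)
    moreover have "x < y"
      using cycle_point_less_iff[OF k, of n "Suc n"] by (simp add: x_def y_def divide_strict_right_mono)
    moreover have "x \<in> X_points k m" "y \<in> X_points k m"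
      unfolding X xy using cycle_point_in_lift[OF k] by blast+
    moreover have "X_points k m \<inter> {x<..<y} = {}"
    proof safe
      fix s assume s: "s \<in> X_points k m" "s \<in> {x<..<y}"
      then have "3 ^ m * x < 3 ^ m * s" "3 ^ m * s < 3 ^ m * y" by simp_all
      then have False using cycle_lift_gap[OF assms] s(1) unfolding X xy by blast
      then show "s \<in> {}" ..
    qed
    moreover have "\<bar>x - y\<bar> = 2 * 3 ^ n / (3 ^ m * (3 ^ k - 1))"
    proof -
      have "x - y = - (2 * cycle_point k n / 3 ^ m)"
        by (simp add: x_def y_def cycle_point_Suc field_simps)
      then have "\<bar>x - y\<bar> = 2 * cycle_point k n / 3 ^ m"
        using cycle_point_pos[OF k, of n] by simp
      then show ?thesis by (simp add: cycle_point_def field_simps)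
    qed
    ultimately show "?f j \<in> edges_of_type k m n"
      by (simp add: edges_of_type_def edges_def x_def[symmetric] y_def[symmetric])
  qed
  show "edges_of_type k m n \<subseteq> ?f ` {..<3 ^ m}"
  proof
    fix e assume e: "e \<in> edges_of_type k m n"
    obtain x y where xy: "e = (x, y)" by (cases e)
    have *: "x \<in> X_points k m" "y \<in> X_points k m" "0 \<le> x" "x < 1" "x < y"
      "X_points k m \<inter> {x<..<y} = {}" "\<bar>x - y\<bar> = 2 * 3 ^ n / (3 ^ m * (3 ^ k - 1))"
      using e by (auto simp: edges_of_type_def edges_def xy)
    obtain i z where x: "3 ^ m * x = cycle_point k i + of_int z" "i < k"
      using *(1) unfolding X by (auto simp: cycle_lift_def)
    \<comment> \<open>The right end of the gap that starts at \<open>x\<close>. If \<open>y\<close>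
      were larger, the vertex \<open>y'\<close> would lie inside the edge; if smaller,
      \<open>y\<close> would lie inside the gap.\<close>
    define y' where "y' = (cycle_point k (Suc i) + of_int z) / 3 ^ m"
    have y': "3 ^ m * y' = cycle_point k (Suc i) + of_int z" by (simp add: y'_def)
    have "3 ^ m * x < 3 ^ m * y'"
      unfolding x y' using cycle_point_less_iff[OF k, of i "Suc i"] by simp
    then have "x < y'" by simp
    have "y' \<in> X_points k m" unfolding X y' by (rule cycle_point_in_lift[OF k])
    then have "y \<le> y'" using *(6) \<open>x < y'\<close> by (meson disjoint_iff greaterThanLessThan_iff not_le)
    moreover have "\<not> y < y'"
    proof
      assume "y < y'"
      then have "3 ^ m * x < 3 ^ m * y" "3 ^ m * y < 3 ^ m * y'" using *(5) by simp_all
      then show False using cycle_lift_gap[OF x(2)] *(2) unfolding X x y' by blast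
    qed
    ultimately have "y = y'" by simp
    have "x = (cycle_point k i + of_int z) / 3 ^ m" using x by (simp add: field_simps)
    then have "y - x = 2 * cycle_point k i / 3 ^ m"
      by (simp add: \<open>y = y'\<close> y'_def cycle_point_Suc field_simps)
    moreover have "y - x = 2 * cycle_point k n / 3 ^ m"
      using *(5,7) by (simp add: cycle_point_def field_simps)
    ultimately have "cycle_point k i = cycle_point k n" by simp
    then have "i = n" using cycle_point_less_iff[OF k] by (metis nat_neq_iff)
    \<comment> \<open>As \<open>0 < a_i < 1\<close>, the normalisation \<open>0 \<le> x < 1\<close>
      forces \<open>0 \<le> z < 3 ^ m\<close>.\<close>
    have "3 ^ m * x < 3 ^ m" "0 \<le> 3 ^ m * x" using *(3,4) by simp_all
    then have "real_of_int z > -1" "real_of_int z < 3 ^ m"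
      unfolding x(1) using cycle_point_pos[OF k, of i] cycle_point_less_1[OF x(2)] by linarith+
    then have "0 \<le> z" "z < 3 ^ m"
      by linarith (metis \<open>real_of_int z < 3 ^ m\<close> of_int_less_iff of_int_numeral of_int_power)
    then have "nat z < 3 ^ m" "real (nat z) = of_int z"
      by (simp_all add: nat_less_iff)
    then show "e \<in> ?f ` {..<3 ^ m}"
      using \<open>x = _\<close> \<open>y = y'\<close> \<open>i = n\<close> xy by (intro image_eqI[of _ _ "nat z"]) (simp_all add: y'_def)
  qed
qed

section \<open>Level energies as weighted sums of squared differences\<close>

definition edge_square :: "nat \<Rightarrow> (real \<Rightarrow> real) \<Rightarrow> nat \<Rightarrow> nat \<Rightarrow> nat \<Rightarrow> real" where
  "edge_square k u m n j =
     (u ((cycle_point k n + real j) / 3 ^ m) - u ((cycle_point k (Suc n) + real j) / 3 ^ m))\<^sup>2"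

lemma ratio_pos: "ratio k > 0"
  by (simp add: ratio_def)

lemma ratio_power: "k \<ge> 1 \<Longrightarrow> ratio k ^ k = 3 ^ (k - 1)"
  unfolding ratio_def by (subst powr_power) (auto simp: powr_realpow[symmetric] of_nat_diff)

lemma level_energy_eq:
  assumes "k \<ge> 1"
  shows "level_energy k m u =
    (3 ^ k - 1) / 2 * (3 / ratio k) ^ m * (\<Sum>n<k. (ratio k / 3) ^ n * (\<Sum>j<3 ^ m. edge_square k u m n j))"
proof -
  have "ratio k ^ n * (\<Sum>(x, y)\<in>edges_of_type k m n. \<bar>u x - u y\<bar>\<^sup>2 / \<bar>x - y\<bar>)
      = (3 ^ k - 1) / 2 * 3 ^ m * ((ratio k / 3) ^ n * (\<Sum>j<3 ^ m. edge_square k u m n j))"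
    if "n < k" for n
  proof -
    have "(\<Sum>(x, y)\<in>edges_of_type k m n. \<bar>u x - u y\<bar>\<^sup>2 / \<bar>x - y\<bar>)
        = (\<Sum>(x, y)\<in>edges_of_type k m n. (u x - u y)\<^sup>2 / (2 * 3 ^ n / (3 ^ m * (3 ^ k - 1))))"
      by (rule sum.cong) (auto simp: edges_of_type_def)
    also have "\<dots> = (\<Sum>j<3 ^ m. edge_square k u m n j / (2 * 3 ^ n / (3 ^ m * (3 ^ k - 1))))"
      unfolding edges_of_type_eq[OF that]
      by (subst sum.reindex) (auto simp: inj_on_def edge_square_def)
    also have "\<dots> = (3 ^ k - 1) / 2 * 3 ^ m / 3 ^ n * (\<Sum>j<3 ^ m. edge_square k u m n j)"
      by (simp add: sum_distrib_left sum_divide_distrib mult_ac)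
    finally show ?thesis by (simp add: power_divide)
  qed
  then have "level_energy k m u = 1 / ratio k ^ m * (\<Sum>n<k. (3 ^ k - 1) / 2 * 3 ^ m *
      ((ratio k / 3) ^ n * (\<Sum>j<3 ^ m. edge_square k u m n j)))"
    unfolding level_energy_def by (intro arg_cong[where f = "(*) (1 / ratio k ^ m)"] sum.cong) simp_all
  then show ?thesis
    by (simp only: sum_distrib_left[symmetric]) (simp add: power_divide)
qed

section \<open>Kneading sequences and identified vertices\<close>

lemma mem_kneading_arc_iff:
  assumes "n < 3"
  shows "s \<in> kneading_arc k n \<longleftrightarrow> (\<lceil>3 * s - cycle_point k 0\<rceil> - 1) mod 3 = int n"
proof -
  \<comment> \<open>Tripling turns arc \<open>n\<close> into the interval from
    \<open>a_0 + n\<close> to \<open>a_0 + n + 1\<close> modulo 3, open on the left and closed on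
    the right, which is what a ceiling detects.\<close>
  have "s + of_int z \<in> {theta k + real n / 3 <.. theta k + (real n + 1) / 3}
      \<longleftrightarrow> \<lceil>3 * s - cycle_point k 0\<rceil> = int n + 1 - 3 * z" for z :: int
    unfolding ceiling_eq_iff by (auto simp: theta_eq field_simps)
  moreover have "(\<exists>z. c = int n + 1 - 3 * z) \<longleftrightarrow> (c - 1) mod 3 = int n" for c
    using assms by presburger
  ultimately show ?thesis by (simp add: kneading_arc_def)
qed

lemma kneading_eq: "kneading k t j = nat ((\<lceil>3 ^ Suc j * t - cycle_point k 0\<rceil> - 1) mod 3)"
  unfolding kneading_def
proof (rule the_equality)
  let ?c = "(\<lceil>3 ^ Suc j * t - cycle_point k 0\<rceil> - 1) mod 3"
  have c: "3 * (3 ^ j * t) = 3 ^ Suc j * t" "0 \<le> ?c" "?c < 3" by simp_all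
  then have "nat ?c < 3" by linarith
  with c show "nat ?c < 3 \<and> 3 ^ j * t \<in> kneading_arc k (nat ?c)"
    by (simp only: mem_kneading_arc_iff) simp
  show "n = nat ?c" if "n < 3 \<and> 3 ^ j * t \<in> kneading_arc k n" for n
    using that c(1) by (metis mem_kneading_arc_iff nat_int)
qed

lemma kneading_power_mult: "kneading k (3 ^ m * t) i = kneading k t (i + m)"
  by (simp add: kneading_def power_add mult.assoc)

text \<open>For \<open>1 \<le> i \<le> k\<close> the difference is positive and at most 1. For
  \<open>i > k\<close>, passing from \<open>i - k\<close> to \<open>i\<close> adds
  \<open>3 ^ (i - k)\<close>, a multiple of 3.\<close>

lemma ceiling_cycle_point_diff:
  assumes "k \<ge> 1" "i \<ge> 1" shows "(\<lceil>cycle_point k i - cycle_point k 0\<rceil> - 1) mod 3 = 0"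
  using assms(2)
proof (induction i rule: less_induct)
  case (less i)
  show ?case
  proof (cases "i \<le> k")
    case True
    then have "\<lceil>cycle_point k i - cycle_point k 0\<rceil> = 1"
      using less.prems cycle_point_less_iff[OF assms(1), of 0 i] cycle_point_le_iff[OF assms(1), of i k]
        cycle_point_period[OF assms(1)] unfolding ceiling_eq_iff by simp
    then show ?thesis by simp
  next
    case False
    define d where "d = i - k"
    have d: "i = k + d" "d \<ge> 1" "d < i"
      using False assms(1) by (auto simp: d_def)
    have "cycle_point k i - cycle_point k 0 = cycle_point k d - cycle_point k 0 + of_int (3 ^ d)"
      using cycle_point_add[OF assms(1)] d(1) by simp
    then have "\<lceil>cycle_point k i - cycle_point k 0\<rceil> - 1 = (\<lceil>cycle_point k d - cycle_point k 0\<rceil> - 1) + 3 ^ d"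
      by (simp only: ceiling_add_of_int)
    moreover have "(3::int) dvd 3 ^ d" using d(2) by (simp add: dvd_power)
    ultimately show ?thesis using less.IH[OF d(3,2)] by (metis dvd_add mod_0_imp_dvd dvd_imp_mod_0)
  qed
qed

text \<open>The sequence is \<open>z mod 3, 0, 0, ...\<close>, independently of \<open>i\<close>:
  this is the source of the identifications. At \<open>i = 0\<close> the first symbol would drop by
  one, because the ceiling of \<open>a_0 - a_0\<close> is 0 rather than 1.\<close>

lemma kneading_third_cycle_point:
  assumes "k \<ge> 1" "i \<ge> 1" "3 * t = cycle_point k i + of_int z"
  shows "kneading k t j = nat ((3 ^ j * z) mod 3)"
proof -
  have "3 ^ Suc j * t - cycle_point k 0 = 3 ^ j * (3 * t) - cycle_point k 0" by simp
  also have "\<dots> = cycle_point k (i + j) - cycle_point k 0 + of_int (3 ^ j * z)"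
    by (simp add: assms(3) distrib_left power_mult_cycle_point)
  finally have "\<lceil>3 ^ Suc j * t - cycle_point k 0\<rceil> - 1
      = (\<lceil>cycle_point k (i + j) - cycle_point k 0\<rceil> - 1) + 3 ^ j * z"
    by (simp only: ceiling_add_of_int)
  moreover have "(\<lceil>cycle_point k (i + j) - cycle_point k 0\<rceil> - 1) mod 3 = 0"
    using assms by (intro ceiling_cycle_point_diff) auto
  ultimately have "(\<lceil>3 ^ Suc j * t - cycle_point k 0\<rceil> - 1) mod 3 = (3 ^ j * z) mod 3"
    by (metis add.left_neutral mod_add_left_eq)
  then show ?thesis by (simp only: kneading_eq)
qed

text \<open>The first \<open>m\<close> symbols of the kneading sequence only change at points \<open>t\<close> for which \<open>3 ^ m * t\<close>
  lies in the cycle.\<close>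

lemma kneading_eq_if_same_gap:
  assumes n: "n < k"
    and "cycle_point k n + of_int z < 3 ^ m * s" "3 ^ m * s \<le> cycle_point k (Suc n) + of_int z"
    and "cycle_point k n + of_int z < 3 ^ m * t" "3 ^ m * t \<le> cycle_point k (Suc n) + of_int z"
    and "kneading k (3 ^ m * s) = kneading k (3 ^ m * t)"
  shows "kneading k s = kneading k t"
  using assms(2-)
proof (induction s t rule: linorder_wlog)
  case (sym s t)
  show ?case by (rule sym.IH[symmetric]) (use sym.prems in auto)
next
  case (le s t)
  have k: "1 \<le> k" using n by simp
  show ?case
  proof
    fix j
    show "kneading k s j = kneading k t j"
    proof (cases "m \<le> j")
      case True
      then have "kneading k s j = kneading k (3 ^ m * s) (j - m)" "kneading k t j = kneading k (3 ^ m * t) (j - m)"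
        by (simp_all add: kneading_power_mult)
      then show ?thesis using le by simp
    next
      case False
      \<comment> \<open>If the ceiling jumped between \<open>s\<close> and \<open>t\<close>, then
        \<open>a_0 + q\<close> would separate their multiples by \<open>3 ^ Suc j\<close>.
        Multiplied by \<open>3 ^ (m - Suc j)\<close> it would be an orbit point strictly inside the
        gap.\<close>
      define q where "q = \<lceil>3 ^ Suc j * s - cycle_point k 0\<rceil>"
      have "q \<le> \<lceil>3 ^ Suc j * t - cycle_point k 0\<rceil>"
        unfolding q_def by (intro ceiling_mono diff_right_mono mult_left_mono le) simp
      moreover have "\<not> q < \<lceil>3 ^ Suc j * t - cycle_point k 0\<rceil>"
      proof
        assume "q < \<lceil>3 ^ Suc j * t - cycle_point k 0\<rceil>"
        then have "cycle_point k 0 + of_int q < 3 ^ Suc j * t"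
          by (simp only: less_ceiling_iff)
        moreover have "3 ^ Suc j * s \<le> cycle_point k 0 + of_int q"
          using le_of_int_ceiling[of "3 ^ Suc j * s - cycle_point k 0"] unfolding q_def by linarith
        ultimately have *: "3 ^ (m - Suc j) * (3 ^ Suc j * s) \<le> 3 ^ (m - Suc j) * (cycle_point k 0 + of_int q)"
          "3 ^ (m - Suc j) * (cycle_point k 0 + of_int q) < 3 ^ (m - Suc j) * (3 ^ Suc j * t)"
          by (auto intro!: mult_left_mono mult_strict_left_mono)
        have "(3::real) ^ (m - Suc j) * (3 ^ Suc j * x) = 3 ^ m * x" for x
          using False by (simp only: mult.assoc[symmetric] power_add[symmetric]) simp
        note * = *[unfolded this]
        show False
        proof (rule cycle_lift_gap[OF n, where z = z])
          show "3 ^ (m - Suc j) * (cycle_point k 0 + of_int q) \<in> cycle_lift k"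
            by (intro power_mult_cycle_lift cycle_point_in_lift k)
        qed (use * le in linarith)+
      qed
      ultimately have "q = \<lceil>3 ^ Suc j * t - cycle_point k 0\<rceil>" by linarith
      then show ?thesis by (simp only: kneading_eq q_def)
    qed
  qed
qed

text \<open>After multiplication by \<open>3 ^ m\<close> the points are thirds of
  \<open>a_i + j\<close>, with equal kneading sequences. If 3 does not divide \<open>j\<close> they
  also share one longest gap, so the first \<open>m\<close> symbols agree as well; if 3 divides
  \<open>j\<close> they are the orbit points \<open>a_(i-1)\<close> translated by
  \<open>j div 3\<close>.\<close>

lemma cycle_points_identified:
  assumes u: "respects_identifications k u" and i: "1 \<le> i" "i \<le> k" "1 \<le> i'" "i' \<le> k"
    and j: "j mod 3 \<noteq> 0"
  shows "u ((cycle_point k i + real j) / 3 ^ Suc m) = u ((cycle_point k i' + real j) / 3 ^ Suc m)"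
proof -
  have k: "1 \<le> k" and k1: "k - 1 < k" "Suc (k - 1) = k" using i by auto
  define pt where "pt i = (cycle_point k i + real j) / 3 ^ Suc m" for i
  have pt: "3 * (3 ^ m * pt i) = cycle_point k i + of_int (int j)" for i
    by (simp add: pt_def)
  define q where "q = j div 3"
  have "j = 3 * q + j mod 3" by (simp add: q_def)
  then have "3 * q + 1 \<le> j" "j \<le> 3 * q + 2" using j by linarith+
  then have q: "3 * real q + 1 \<le> real j" "real j \<le> 3 * real q + 2" by linarith+
  \<comment> \<open>Three times the longest gap runs from \<open>a_0 + 1 + 3 * q\<close> to
    \<open>3 * a_0 + 3 + 3 * q\<close>, which leaves room for both \<open>j = 3 * q + 1\<close> and
    \<open>j = 3 * q + 2\<close>.\<close>
  have gap: "cycle_point k (k - 1) + of_int (int q) < 3 ^ m * pt i \<and>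
      3 ^ m * pt i \<le> cycle_point k (Suc (k - 1)) + of_int (int q)" if "1 \<le> i" "i \<le> k" for i
  proof -
    have "cycle_point k 0 < cycle_point k i" "cycle_point k i \<le> cycle_point k k"
      using that cycle_point_less_iff[OF k] cycle_point_le_iff[OF k] by auto
    moreover have "3 * cycle_point k (k - 1) = cycle_point k 0 + 1" "cycle_point k k = cycle_point k 0 + 1"
      using cycle_point_Suc[of k "k - 1"] cycle_point_period[OF k] k1 by simp_all
    moreover have "0 < cycle_point k 0" by (rule cycle_point_pos[OF k])
    ultimately show ?thesis using pt[of i] q unfolding k1(2) of_int_of_nat_eq by linarith
  qed
  have "kneading k (3 ^ m * pt i) = kneading k (3 ^ m * pt i')"
    by (rule ext) (simp only: kneading_third_cycle_point[OF k i(1) pt] kneading_third_cycle_point[OF k i(3) pt])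
  with gap[OF i(1,2)] gap[OF i(3,4)] have "kneading k (pt i) = kneading k (pt i')"
    by (elim conjE) (rule kneading_eq_if_same_gap[OF k1(1)])
  then show ?thesis using u unfolding respects_identifications_def pt_def by blast
qed

section \<open>Monotonicity of the level energies and existence of the limit\<close>

lemma periodic_add_nat:
  fixes u :: "real \<Rightarrow> 'a" assumes "\<And>t. u (t + 1) = u t" shows "u (t + real n) = u t"
proof (induction n)
  case (Suc n)
  then show ?case using assms[of "t + real n"] by (simp add: add_ac)
qed simp

lemma edge_square_nonneg: "edge_square k u m n j \<ge> 0"
  by (simp add: edge_square_def)

lemma edge_square_periodic:
  assumes "\<And>t. u (t + 1) = u t"
  shows "edge_square k u m n (j + 3 ^ m) = edge_square k u m n j"
proof -
  have "u ((a + real (j + 3 ^ m)) / 3 ^ m) = u ((a + real j) / 3 ^ m)" for a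
    using assms[of "(a + real j) / 3 ^ m"] by (simp add: field_simps)
  then show ?thesis unfolding edge_square_def by simp
qed

lemma sum_lessThan_triple:
  fixes f :: "nat \<Rightarrow> 'a::comm_monoid_add"
  shows "(\<Sum>j<3 * N. f j) = (\<Sum>j<N. f (3 * j) + f (3 * j + 1) + f (3 * j + 2))"
  by (induction N) (simp_all add: add_ac numeral_3_eq_3)

text \<open>Both sides describe the same arc, since \<open>a_(i+1) = 3 * a_i\<close>. For
  \<open>Suc n < k\<close> this arc is an edge of the next level too: all edges except the longest
  survive refinement.\<close>

lemma edge_square_refine:
  "edge_square k u m n j = edge_square k u (Suc m) (Suc n) (3 * j)"
proof -
  have "(cycle_point k i + real j) / 3 ^ m = (cycle_point k (Suc i) + real (3 * j)) / 3 ^ Suc m" for i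
    by (simp add: cycle_point_Suc field_simps)
  then show ?thesis unfolding edge_square_def by simp
qed

lemma power2_sum3_le: "(a + b + c)\<^sup>2 \<le> 3 * (a\<^sup>2 + b\<^sup>2 + (c::real)\<^sup>2)"
proof -
  have "0 \<le> (a - b)\<^sup>2 + (b - c)\<^sup>2 + (a - c)\<^sup>2" by simp
  then show ?thesis by (simp add: power2_eq_square algebra_simps)
qed

text \<open>An edge of the longest type is subdivided into \<open>2 * k + 1\<close> edges; identifications kill
  the differences over all but three of them.\<close>

lemma edge_square_longest_le:
  assumes u: "respects_identifications k u" and k: "k = Suc n"
  shows "edge_square k u m n j \<le> 3 * (edge_square k u (Suc m) 0 (3 * j + 1) +
    edge_square k u (Suc m) 0 (3 * j + 2) + edge_square k u (Suc m) 0 (3 * j + 3))"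
proof -
  define p where "p i l = u ((cycle_point k i + real l) / 3 ^ Suc m)" for i l
  have shift: "p k l = p 0 l'" if "l' = l + 1" for l l'
    using cycle_point_period[of k] k that by (simp add: p_def add_ac)
  have ident: "p 1 l = p k l" if "l mod 3 \<noteq> 0" for l
    unfolding p_def by (rule cycle_points_identified[OF u]) (use that k in auto)
  have "(cycle_point k n + real j) / 3 ^ m = (cycle_point k (Suc n) + real (3 * j)) / 3 ^ Suc m"
    by (simp add: cycle_point_Suc field_simps)
  then have "u ((cycle_point k n + real j) / 3 ^ m) = p k (3 * j)"
    by (simp add: p_def k)
  moreover have "(cycle_point k k + real j) / 3 ^ m = (cycle_point k 1 + real (3 * j + 3)) / 3 ^ Suc m"
    using cycle_point_period[of k] k by (simp add: cycle_point_Suc field_simps)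
  then have "u ((cycle_point k (Suc n) + real j) / 3 ^ m) = p 1 (3 * j + 3)"
    unfolding p_def k[symmetric] by simp
  moreover have "p 1 (3 * j + 1) = p k (3 * j + 1)" "p 1 (3 * j + 2) = p k (3 * j + 2)"
    by (rule ident, presburger)+
  moreover have "p k (3 * j) = p 0 (3 * j + 1)" "p k (3 * j + 1) = p 0 (3 * j + 2)"
    "p k (3 * j + 2) = p 0 (3 * j + 3)"
    by (rule shift, simp)+
  \<comment> \<open>In units of the finer level, the chain crosses the edges from
    \<open>a_0 + l\<close> to \<open>a_1 + l\<close> for
    \<open>l = 3 * j + 1, 3 * j + 2, 3 * j + 3\<close>. Between two crossings,
    \<open>a_1 + l\<close> is identified with \<open>a_k + l = a_0 + l + 1\<close>.\<close>
  ultimately have "edge_square k u m n j = ((p 0 (3 * j + 1) - p 1 (3 * j + 1)) +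
      (p 0 (3 * j + 2) - p 1 (3 * j + 2)) + (p 0 (3 * j + 3) - p 1 (3 * j + 3)))\<^sup>2"
    by (simp add: edge_square_def)
  also have "\<dots> \<le> 3 * ((p 0 (3 * j + 1) - p 1 (3 * j + 1))\<^sup>2 +
      (p 0 (3 * j + 2) - p 1 (3 * j + 2))\<^sup>2 + (p 0 (3 * j + 3) - p 1 (3 * j + 3))\<^sup>2)"
    by (rule power2_sum3_le)
  finally show ?thesis by (simp add: edge_square_def p_def)
qed

text \<open>Let \<open>w = ratio k / 3\<close>. An edge that survives moves from type
  \<open>n\<close> to \<open>n + 1\<close>, and \<open>w ^ n = w ^ (n + 1) / w\<close> matches the
  change of prefactor. The Cauchy-Schwarz factor 3 on the longest edges is absorbed because
  \<open>3 * w ^ (k - 1) = 1 / w\<close>; the value of \<open>ratio k\<close> is tuned to this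
  identity.\<close>

lemma level_energy_mono:
  assumes "k \<ge> 1" and u: "respects_identifications k u"
  shows "level_energy k m u \<le> level_energy k (Suc m) u"
proof -
  obtain k' where k: "k = Suc k'" using assms(1) by (cases k) auto
  note per = respects_identifications_periodic[OF u]
  define S where "S m n = (\<Sum>j<3 ^ m. edge_square k u m n j)" for m n
  define w where "w = ratio k / 3"
  have w: "w > 0" using ratio_pos[of k] by (simp add: w_def)
  have w_k: "w ^ k = 1 / 3"
    using ratio_power[OF assms(1)] by (simp add: w_def power_divide k)
  have split: "S (Suc m) n = (\<Sum>j<3 ^ m. edge_square k u (Suc m) n (3 * j) +
      edge_square k u (Suc m) n (3 * j + 1) + edge_square k u (Suc m) n (3 * j + 2))" for n
    unfolding S_def power_Suc by (rule sum_lessThan_triple)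
  have short: "S m n \<le> S (Suc m) (Suc n)" for n
    unfolding split unfolding S_def
    by (intro sum_mono) (simp add: edge_square_refine[symmetric] edge_square_nonneg)
  have "S m k' \<le> (\<Sum>j<3 ^ m. 3 * (edge_square k u (Suc m) 0 (3 * j + 1) +
    edge_square k u (Suc m) 0 (3 * j + 2) + edge_square k u (Suc m) 0 (3 * j + 3)))"
    unfolding S_def by (intro sum_mono edge_square_longest_le u k)
  also have "\<dots> = 3 * (\<Sum>j<3 ^ Suc m. edge_square k u (Suc m) 0 (Suc j))"
    unfolding power_Suc sum_lessThan_triple by (simp add: sum_distrib_left numeral_3_eq_3)
  \<comment> \<open>The shifted sum has the index \<open>3 ^ Suc m\<close> in place of 0; by
    periodicity the two terms are equal.\<close>
  also have "(\<Sum>j<3 ^ Suc m. edge_square k u (Suc m) 0 (Suc j)) = S (Suc m) 0"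
    using sum.lessThan_Suc_shift[of "edge_square k u (Suc m) 0" "3 ^ Suc m"]
      edge_square_periodic[of u, OF per, of k "Suc m" 0 0]
    unfolding S_def by simp
  finally have "S m k' \<le> 3 * S (Suc m) 0" .
  then have "w ^ k' * S m k' \<le> w ^ k' * (3 * S (Suc m) 0)"
    using w by simp
  also have "\<dots> = S (Suc m) 0 / w"
    using w_k w by (simp add: k field_simps)
  finally have long: "w ^ k' * S m k' \<le> S (Suc m) 0 / w" .
  have "(\<Sum>n<k. w ^ n * S m n) = (\<Sum>n<k'. w ^ n * S m n) + w ^ k' * S m k'"
    by (simp add: k)
  also have "\<dots> \<le> (\<Sum>n<k'. w ^ n * S (Suc m) (Suc n)) + S (Suc m) 0 / w"
    using w by (intro add_mono sum_mono mult_left_mono short long) auto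
  also have "\<dots> = (\<Sum>n<k. w ^ n * S (Suc m) n) / w"
    using w unfolding k sum.lessThan_Suc_shift by (simp add: add_divide_distrib sum_divide_distrib)
  finally have "(3 ^ k - 1) / 2 * (1 / w) ^ m * (\<Sum>n<k. w ^ n * S m n) \<le>
      (3 ^ k - 1) / 2 * (1 / w) ^ m * ((\<Sum>n<k. w ^ n * S (Suc m) n) / w)"
    using w three_power_gt_1[OF assms(1)] by (intro mult_left_mono) auto
  then show ?thesis
    unfolding level_energy_eq[OF assms(1)] S_def w_def by (simp add: mult_ac)
qed

text \<open>\<open>lim\<close> carries no information until convergence is known. A nondecreasing
  sequence in \<open>ennreal\<close> converges to its supremum, possibly infinite.\<close>

lemma energy_LIMSEQ:
  assumes "k \<ge> 1" "respects_identifications k u"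
  shows "(\<lambda>m. ennreal (level_energy k m u)) \<longlonglongrightarrow> energy k u"
proof -
  have "incseq (\<lambda>m. ennreal (level_energy k m u))"
    by (intro incseq_SucI ennreal_leI level_energy_mono assms)
  from LIMSEQ_SUP[OF this] show ?thesis
    unfolding energy_def by (simp add: limI)
qed

section \<open>Functions on the quotient and composition with tripling\<close>

lemma periodic_add_int:
  fixes u :: "real \<Rightarrow> 'a" assumes "\<And>t. u (t + 1) = u t" shows "u (t + of_int z) = u t"
proof (cases z)
  case (nonneg n)
  then show ?thesis using periodic_add_nat[of u, OF assms] by simp
next
  case (neg n)
  then show ?thesis using periodic_add_nat[of u, OF assms, of "t + of_int z" "Suc n"] by simp
qed

lemma comp_P_map:
  assumes "\<And>t. v (t + 1) = v t" shows "v \<circ> P_map = (\<lambda>t. v (3 * t))"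
proof
  fix t
  show "(v \<circ> P_map) t = v (3 * t)"
    using periodic_add_int[of v, OF assms, of "P_map t" "\<lfloor>3 * t\<rfloor>"] by (simp add: P_map_def frac_def)
qed

lemma julia_functions_periodic: "u \<in> julia_functions k \<Longrightarrow> u (t + 1) = u t"
  using respects_identifications_periodic by (auto simp: julia_functions_def)

lemma julia_functions_add:
  assumes "u \<in> julia_functions k" "v \<in> julia_functions k" shows "(\<lambda>t. u t + v t) \<in> julia_functions k"
  using assms unfolding julia_functions_def respects_identifications_def mem_Collect_eq
  by (safe intro!: continuous_intros) metis

lemma julia_functions_diff:
  assumes "u \<in> julia_functions k" "v \<in> julia_functions k" shows "(\<lambda>t. u t - v t) \<in> julia_functions k"
  using assms unfolding julia_functions_def respects_identifications_def mem_Collect_eq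
  by (safe intro!: continuous_intros) metis

lemma kneading_triple: "kneading k (3 * t) j = kneading k t (Suc j)"
  using kneading_power_mult[of k 1 t j] by simp

lemma julia_functions_triple:
  assumes "v \<in> julia_functions k" shows "(\<lambda>t. v (3 * t)) \<in> julia_functions k"
proof -
  have "kneading k (3 * s) = kneading k (3 * t)" if "kneading k s = kneading k t" for s t
    using fun_cong[OF that] by (auto simp: kneading_triple)
  moreover have "continuous_on UNIV (\<lambda>t. v (3 * t))"
    using assms
    by (intro continuous_on_compose2[where t = UNIV and g = v and f = "\<lambda>t. 3 * t"] continuous_on_mult_left continuous_on_id)
      (simp_all add: julia_functions_def)
  ultimately show ?thesis
    using assms unfolding julia_functions_def respects_identifications_def mem_Collect_eq by blast
qed

text \<open>Every point has a preimage under tripling in the arc with symbol \<open>0\<close>, and for points with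
  the same kneading sequence these preimages are identified.\<close>

lemma julia_functions_third:
  assumes u: "u \<in> julia_functions k" and rot: "\<And>t. u (t + 1/3) = u t"
  shows "(\<lambda>t. u (t / 3)) \<in> julia_functions k"
proof -
  define v where "v t = u (t / 3)" for t
  have "v (t + 1) = v t" for t
    using rot[of "t / 3"] by (simp add: v_def add_divide_distrib)
  note v_per = periodic_add_int[of v, OF this]
  \<comment> \<open>The added integer makes the ceiling of \<open>3 * lift t - a_0\<close> equal to
    1, which is symbol 0. By 1/3-periodicity it does not affect the value of
    \<open>u\<close>.\<close>
  define lift where "lift t = (t + of_int (1 - \<lceil>t - cycle_point k 0\<rceil>)) / 3" for t
  have lift_0: "kneading k (lift t) 0 = 0" for t
  proof -
    have "3 ^ Suc 0 * lift t - cycle_point k 0 = t - cycle_point k 0 + of_int (1 - \<lceil>t - cycle_point k 0\<rceil>)"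
      by (simp add: lift_def)
    then have "\<lceil>3 ^ Suc 0 * lift t - cycle_point k 0\<rceil> = 1"
      by (simp only: ceiling_add_of_int)
    then show ?thesis by (simp only: kneading_eq) simp
  qed
  have lift_Suc: "kneading k (lift t) (Suc j) = kneading k t j" for t j
  proof -
    have "3 * lift t = t + of_int (1 - \<lceil>t - cycle_point k 0\<rceil>)"
      by (simp add: lift_def field_simps)
    then have "kneading k (lift t) (Suc j) = kneading k (t + of_int (1 - \<lceil>t - cycle_point k 0\<rceil>)) j"
      by (simp only: kneading_triple[symmetric])
    then show ?thesis
      by (simp only: periodic_add_int[of "kneading k", OF kneading_plus_1])
  qed
  have "kneading k (lift s) = kneading k (lift t)" if "kneading k s = kneading k t" for s t
  proof
    fix j show "kneading k (lift s) j = kneading k (lift t) j"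
      using that by (cases j) (simp_all only: lift_0 lift_Suc)
  qed
  then have "u (lift s) = u (lift t)" if "kneading k s = kneading k t" for s t
    using u that unfolding julia_functions_def respects_identifications_def by blast
  moreover have "u (lift t) = v t" for t
    using v_per[of t] unfolding lift_def v_def by blast
  ultimately have "respects_identifications k v"
    unfolding respects_identifications_def by metis
  moreover have "continuous_on UNIV v"
    unfolding v_def using u
    by (intro continuous_on_compose2[where t = UNIV and g = u and f = "\<lambda>t. t / 3"] continuous_on_divide continuous_on_id continuous_on_const)
      (simp_all add: julia_functions_def)
  ultimately show ?thesis unfolding julia_functions_def v_def by simp
qed

section \<open>Scaling of the energy under tripling\<close>

definition tripling_factor :: "nat \<Rightarrow> real" where
  "tripling_factor k = 3 powr ((real k + 1) / real k)"

lemma tripling_factor_pos: "tripling_factor k > 0"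
  by (simp add: tripling_factor_def)

lemma tripling_factor_eq:
  assumes "k \<ge> 1" shows "tripling_factor k = 9 / ratio k"
proof -
  have "(real k + 1) / real k = 2 - (real k - 1) / real k" using assms by (simp add: field_simps)
  then show ?thesis by (simp add: tripling_factor_def ratio_def powr_diff)
qed

lemma sum_lessThan_triple_periodic:
  fixes f :: "nat \<Rightarrow> 'a::semiring_1" assumes "\<And>j. f (j + N) = f j"
  shows "(\<Sum>j<3 * N. f j) = 3 * (\<Sum>j<N. f j)"
proof -
  have split: "(\<Sum>j<M + L. f j) = (\<Sum>j<M. f j) + (\<Sum>j<L. f (j + M))" for M L
    by (induction L) (simp_all add: add_ac)
  have "f (j + (N + N)) = f j" for j
    using assms[of "j + N"] assms[of j] by (simp only: add.assoc)
  then have "(\<Sum>j<(N + N) + N. f j) = (\<Sum>j<N. f j) + (\<Sum>j<N. f j) + (\<Sum>j<N. f j)"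
    by (simp only: split assms)
  moreover have "(N + N) + N = 3 * N" by simp
  moreover have "x + x + x = 3 * x" for x :: 'a
    using distrib_right[of 2 1 x] by (simp add: mult_2)
  ultimately show ?thesis by (simp only:)
qed

text \<open>Each edge of level \<open>m\<close> has three preimages of the same type at level
  \<open>m + 1\<close>, giving a factor 3; the prefactor of the level contributes
  \<open>3 / ratio k\<close>. The product is \<open>9 / ratio k\<close>.\<close>

lemma level_energy_triple:
  assumes "k \<ge> 1" "\<And>t. v (t + 1) = v t"
  shows "level_energy k (Suc m) (\<lambda>t. v (3 * t)) = tripling_factor k * level_energy k m v"
proof -
  have "3 * (x / 3 ^ Suc m) = x / 3 ^ m" for x :: real by simp
  then have "edge_square k (\<lambda>t. v (3 * t)) (Suc m) n j = edge_square k v m n j" for n j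
    unfolding edge_square_def by (simp only:)
  then have "(\<Sum>j<3 ^ Suc m. edge_square k (\<lambda>t. v (3 * t)) (Suc m) n j)
      = 3 * (\<Sum>j<3 ^ m. edge_square k v m n j)" for n
    unfolding power_Suc by (simp only: sum_lessThan_triple_periodic edge_square_periodic[of v, OF assms(2)])
  then have "level_energy k (Suc m) (\<lambda>t. v (3 * t)) = (3 ^ k - 1) / 2 * (3 / ratio k) ^ Suc m *
      (\<Sum>n<k. 3 * ((ratio k / 3) ^ n * (\<Sum>j<3 ^ m. edge_square k v m n j)))"
    unfolding level_energy_eq[OF assms(1)] by (simp only: mult.left_commute)
  then show ?thesis
    unfolding level_energy_eq[OF assms(1)] tripling_factor_eq[OF assms(1)]
    by (simp only: sum_distrib_left[symmetric]) simp
qed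

lemma energy_triple:
  assumes k: "k \<ge> 1" and v: "v \<in> julia_functions k"
  shows "energy k (\<lambda>t. v (3 * t)) = ennreal (tripling_factor k) * energy k v"
proof -
  have v3: "(\<lambda>t. v (3 * t)) \<in> julia_functions k" by (rule julia_functions_triple[OF v])
  have "(\<lambda>m. ennreal (tripling_factor k) * ennreal (level_energy k m v))
      \<longlonglongrightarrow> ennreal (tripling_factor k) * energy k v"
    using v by (intro ennreal_tendsto_cmult energy_LIMSEQ k) (auto simp: julia_functions_def)
  moreover have "(\<lambda>m. ennreal (level_energy k (Suc m) (\<lambda>t. v (3 * t)))) \<longlonglongrightarrow> energy k (\<lambda>t. v (3 * t))"
    using v3 by (intro LIMSEQ_Suc energy_LIMSEQ k) (auto simp: julia_functions_def)
  moreover have "ennreal (level_energy k (Suc m) (\<lambda>t. v (3 * t)))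
      = ennreal (tripling_factor k) * ennreal (level_energy k m v)" for m
    using tripling_factor_pos[of k]
    by (simp add: level_energy_triple[of k v, OF k julia_functions_periodic[OF v]] ennreal_mult')
  ultimately show ?thesis using LIMSEQ_unique by simp
qed

lemma dom_energy_triple_iff:
  assumes "k \<ge> 1" "v \<in> julia_functions k"
  shows "(\<lambda>t. v (3 * t)) \<in> dom_energy k \<longleftrightarrow> v \<in> dom_energy k"
  using assms tripling_factor_pos[of k]
  by (auto simp: dom_energy_def julia_functions_triple energy_triple ennreal_mult_less_top ennreal_mult_eq_top_iff less_top)

lemma energy_form_triple:
  assumes "k \<ge> 1" "v \<in> julia_functions k" "w \<in> julia_functions k"
  shows "energy_form k (\<lambda>t. v (3 * t)) (\<lambda>t. w (3 * t)) = tripling_factor k * energy_form k v w"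
  using energy_triple[OF assms(1) julia_functions_add[OF assms(2,3)]]
    energy_triple[OF assms(1) julia_functions_diff[OF assms(2,3)]] tripling_factor_pos[of k]
  by (simp add: energy_form_def enn2real_mult right_diff_distrib)

section \<open>Descent of eigenfunctions along tripling\<close>

lemma integral_triple:
  fixes f :: "real \<Rightarrow> real"
  assumes f: "continuous_on UNIV f" and per: "\<And>t. f (t + 1) = f t"
  shows "(LINT t:{0..<1}|lborel. f (3 * t)) = (LINT t:{0..<1}|lborel. f t)"
proof -
  have int: "set_integrable lborel {a..<b} f" for a b
  proof (rule set_integrable_subset)
    show "set_integrable lborel {a..b} f"
      by (rule borel_integrable_atLeastAtMost') (rule continuous_on_subset[OF f], simp)
  qed auto
  have shift: "(LINT t:{a + 1..<b + 1}|lborel. f t) = (LINT t:{a..<b}|lborel. f t)" for a b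
    unfolding set_lebesgue_integral_def
    by (subst lborel_integral_real_affine[where c = 1 and t = 1])
      (auto intro!: Bochner_Integration.integral_cong simp: indicator_def per add.commute[of 1])
  \<comment> \<open>The substitution leaves one third of an integral over three full
    periods.\<close>
  have "(LINT t:{0..<1}|lborel. f (3 * t)) = (LINT t:{0..<3}|lborel. f t) / 3"
    unfolding set_lebesgue_integral_def
    by (subst (2) lborel_integral_real_affine[where c = 3 and t = 0])
      (auto intro!: Bochner_Integration.integral_cong simp: indicator_def)
  also have "(LINT t:{0..<3}|lborel. f t) =
      (LINT t:{0..<1}|lborel. f t) + (LINT t:{1..<2}|lborel. f t) + (LINT t:{2..<3}|lborel. f t)"
  proof -
    have "{0..<3::real} = {0..<1} \<union> {1..<2} \<union> {2..<3}" by auto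
    then show ?thesis
      using int by (simp add: set_integral_Un set_integrable_Un ivl_disj_int Int_Un_distrib2)
  qed
  also have "(LINT t:{1..<2}|lborel. f t) = (LINT t:{0..<1}|lborel. f t)"
    using shift[of 0 1] by simp
  also have "(LINT t:{2..<3}|lborel. f t) = (LINT t:{0..<1}|lborel. f t)"
    using shift[of 1 2] shift[of 0 1] by simp
  finally show ?thesis by simp
qed

text \<open>It suffices to test the given equation against functions \<open>w (3 * t)\<close> with
  \<open>w\<close> in the domain: they lie in the domain again, the energy form scales by
  \<open>tripling_factor k\<close>, and the integral is invariant.\<close>

lemma eigenspace_untriple:
  assumes k: "k \<ge> 1" and v: "v \<in> julia_functions k" and eig: "(\<lambda>t. v (3 * t)) \<in> eigenspace k lam"
  shows "v \<in> eigenspace k (lam / tripling_factor k)"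
proof -
  have "energy_form k v w = lam / tripling_factor k * (LINT t:{0..<1}|lborel. v t * w t)"
    if w: "w \<in> dom_energy k" for w
  proof -
    have wj: "w \<in> julia_functions k" using w by (simp add: dom_energy_def)
    have "tripling_factor k * energy_form k v w = lam * (LINT t:{0..<1}|lborel. v (3 * t) * w (3 * t))"
      using eig w unfolding eigenspace_def energy_form_triple[OF k v wj, symmetric]
      by (simp add: dom_energy_triple_iff[OF k wj])
    also have "(LINT t:{0..<1}|lborel. v (3 * t) * w (3 * t)) = (LINT t:{0..<1}|lborel. v t * w t)"
      using v wj by (intro integral_triple)
        (auto simp: julia_functions_periodic julia_functions_def intro!: continuous_intros)
    finally show ?thesis using tripling_factor_pos[of k] by (simp add: field_simps)
  qed
  moreover have "v \<in> dom_energy k"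
    using eig by (simp add: eigenspace_def dom_energy_triple_iff[OF k v])
  ultimately show ?thesis by (simp add: eigenspace_def)
qed

text \<open>Periodicity under 1/3 is what makes \<open>u (t / 3)\<close> a function on the circle,
  and hence a candidate for \<open>v\<close>.\<close>

lemma eigenfunction_third:
  assumes k: "k \<ge> 1" and u: "eigenfunction k lam u" and rot: "\<And>t. u (t + 1/3) = u t"
  shows "eigenfunction k (lam / tripling_factor k) (\<lambda>t. u (t / 3))" "u = (\<lambda>t. u (t / 3)) \<circ> P_map"
proof -
  have "u \<in> julia_functions k"
    using u by (simp add: eigenfunction_def eigenspace_def dom_energy_def)
  then have v: "(\<lambda>t. u (t / 3)) \<in> julia_functions k"
    using rot by (rule julia_functions_third)
  show "u = (\<lambda>t. u (t / 3)) \<circ> P_map"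
    using comp_P_map[of "\<lambda>t. u (t / 3)", OF julia_functions_periodic[OF v]] by simp
  have "(\<lambda>t. u (t / 3)) \<in> eigenspace k (lam / tripling_factor k)"
    using u by (intro eigenspace_untriple k v) (simp add: eigenfunction_def)
  moreover have "(\<lambda>t. u (t / 3)) \<noteq> (\<lambda>t. 0)"
  proof
    assume "(\<lambda>t. u (t / 3)) = (\<lambda>t. 0)"
    then have "u (3 * t / 3) = 0" for t by metis
    then show False using u by (simp add: eigenfunction_def fun_eq_iff)
  qed
  ultimately show "eigenfunction k (lam / tripling_factor k) (\<lambda>t. u (t / 3))"
    by (simp add: eigenfunction_def)
qed

section \<open>The rotation acting on functions\<close>

lemma kneading_add_third_cong:
  assumes "kneading k s = kneading k t" shows "kneading k (s + 1/3) = kneading k (t + 1/3)"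
proof
  fix j
  show "kneading k (s + 1/3) j = kneading k (t + 1/3) j"
  proof (cases j)
    case 0
    \<comment> \<open>Adding 1/3 raises this ceiling by exactly one, so the first symbol is permuted
      cyclically; the later symbols do not change, because tripling turns the shift into an
      integer.\<close>
    define c where "c x = (\<lceil>3 ^ Suc 0 * x - cycle_point k 0\<rceil> - 1)" for x
    have "3 ^ Suc 0 * (x + 1/3) - cycle_point k 0 = 3 ^ Suc 0 * x - cycle_point k 0 + of_int 1" for x :: real
      by simp
    then have "c (x + 1/3) = c x + 1" for x
      unfolding c_def by (simp only: ceiling_add_of_int)
    moreover have "c s mod 3 = c t mod 3"
      using fun_cong[OF assms, of 0] unfolding kneading_eq c_def by (simp only: eq_nat_nat_iff pos_mod_sign zero_less_numeral)
    ultimately have "c (s + 1/3) mod 3 = c (t + 1/3) mod 3"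
      by (metis mod_add_left_eq)
    then show ?thesis unfolding 0 kneading_eq c_def by simp
  next
    case (Suc i)
    have "kneading k (x + 1/3) (Suc i) = kneading k x (Suc i)" for x
      using kneading_plus_1[of k "3 * x"] by (simp add: kneading_triple[symmetric] distrib_left)
    then show ?thesis using assms by (simp add: Suc)
  qed
qed

text \<open>\<open>the_elem\<close> returns the intended value only on a singleton, so the point is
  that \<open>u\<close> is constant on the rotated class; this holds because rotation preserves
  equality of kneading sequences.\<close>

lemma compose_julia_rotation:
  assumes "respects_identifications k u"
  shows "compose_julia k u (julia_rotation k) t = u (t + 1/3)"
proof -
  have "julia_point k t \<in> julia k" by (auto simp: julia_eq_range)
  then have "u ` julia_rotation k (julia_point k t) = (\<lambda>s. u (s + 1/3)) ` julia_point k t"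
    by (simp add: julia_rotation_def image_image)
  also have "\<dots> = {u (t + 1/3)}"
  proof -
    have "u (s + 1/3) = u (t + 1/3)" if "s \<in> julia_point k t" for s
      using assms kneading_add_third_cong[of k t s] that
      unfolding respects_identifications_def julia_point_def by (metis mem_Collect_eq)
    moreover have "t \<in> julia_point k t" by (simp add: julia_point_def)
    ultimately show ?thesis by blast
  qed
  finally show ?thesis by (simp add: compose_julia_def)
qed

section \<open>One-dimensional subrepresentations of eigenspaces\<close>

lemma (in vector_space) dim_eq_1E:
  assumes "subspace W" "dim W = 1"
  obtains b where "b \<in> W" "b \<noteq> 0" "W = range (\<lambda>c. scale c b)"
proof -
  obtain B where B: "B \<subseteq> W" "independent B" "W \<subseteq> span B" "card B = dim W"
    by (rule basis_exists)
  then obtain b where b: "B = {b}" using assms(2) by (auto simp: card_1_singleton_iff)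
  have "span B = W" using B assms(1) by (metis span_subspace)
  then have "W = range (\<lambda>c. scale c b)" unfolding b span_singleton by simp
  moreover have "b \<noteq> 0" using B(2) b dependent_zero by blast
  ultimately show ?thesis using that B(1) b by blast
qed

theorem lemma5p2:
  fixes k :: nat
  assumes "k \<ge> 2"
  shows "(\<forall>u. (\<exists>lam. eigenfunction k lam u) \<longrightarrow>
            ((\<exists>v. (\<exists>lam. eigenfunction k lam v) \<and> u = v \<circ> P_map) \<longleftrightarrow> (\<forall>t. u (t + 1/3) = u t))) \<and>
         (\<forall>G lam. dihedral_symmetry_group k G \<and> primitive_eigenvalue k lam \<longrightarrow>
            \<not> (\<exists>W. subrepresentation k G (eigenspace k lam) W \<and> fun_space.dim W = 1))"
proof (intro conjI allI impI)
  have k: "k \<ge> 1" using assms by simp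
  {
    fix u assume "\<exists>lam. eigenfunction k lam u"
    then obtain lam where u: "eigenfunction k lam u" ..
    show "(\<exists>v. (\<exists>lam. eigenfunction k lam v) \<and> u = v \<circ> P_map) \<longleftrightarrow> (\<forall>t. u (t + 1/3) = u t)"
    proof
      assume "\<exists>v. (\<exists>lam. eigenfunction k lam v) \<and> u = v \<circ> P_map"
      then obtain v where u_v: "u = v \<circ> P_map" by blast
      have "P_map (t + 1/3) = P_map t" for t
        by (simp add: P_map_def distrib_left frac_def)
      then show "\<forall>t. u (t + 1/3) = u t" by (simp add: u_v)
    next
      assume "\<forall>t. u (t + 1/3) = u t"
      then show "\<exists>v. (\<exists>lam. eigenfunction k lam v) \<and> u = v \<circ> P_map"
        using eigenfunction_third[OF k u] by blast
    qed
  }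
  fix G lam assume "dihedral_symmetry_group k G \<and> primitive_eigenvalue k lam"
  then have rot: "julia_rotation k \<in> G" and prim: "primitive_eigenvalue k lam"
    by (auto simp: dihedral_symmetry_group_def)
  show "\<not> (\<exists>W. subrepresentation k G (eigenspace k lam) W \<and> fun_space.dim W = 1)"
  proof
    assume "\<exists>W. subrepresentation k G (eigenspace k lam) W \<and> fun_space.dim W = 1"
    then obtain W where W: "fun_space.subspace W" "W \<subseteq> eigenspace k lam" "fun_space.dim W = 1"
      "\<And>u. u \<in> W \<Longrightarrow> compose_julia k u (julia_rotation k) \<in> W"
      using rot unfolding subrepresentation_def by blast
    obtain u where u: "u \<in> W" "u \<noteq> 0" "W = range (\<lambda>c t. c * u t)"
      by (rule fun_space.dim_eq_1E[OF W(1,3)])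
    have eig: "eigenfunction k lam u"
      using u W(2) by (auto simp: eigenfunction_def zero_fun_def)
    then have uj: "u \<in> julia_functions k"
      by (simp add: eigenfunction_def eigenspace_def dom_energy_def)
    obtain c where c: "compose_julia k u (julia_rotation k) = (\<lambda>t. c * u t)"
      using W(4)[OF u(1)] u(3) by blast
    then have "u (t + 1/3) = c * u t" for t
      using compose_julia_rotation[of k u t] uj by (simp add: julia_functions_def)
    note c = this
    obtain t where t: "u t \<noteq> 0" using u(2) by (auto simp: fun_eq_iff)
    \<comment> \<open>The third power of the rotation is the shift by 1, which is trivial on the
      circle.\<close>
    have "u t = u (t + 1/3 + 1/3 + 1/3)"
      using julia_functions_periodic[OF uj, of t] by (simp add: add.assoc)
    also have "\<dots> = c ^ 3 * u t" unfolding c by (simp add: power3_eq_cube)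
    finally have "c ^ 3 = 1" using t by simp
    then have "c = 1" using odd_real_root_unique[of 3 c 1] by simp
    then have "eigenvalue k (lam / tripling_factor k)"
      using eigenfunction_third(1)[OF k eig] c unfolding eigenvalue_def by auto
    moreover have "lam = 3 powr ((real k + 1) / real k) * (lam / tripling_factor k)"
      using tripling_factor_pos[of k] by (simp add: tripling_factor_def)
    ultimately show False using prim unfolding primitive_eigenvalue_def by blast
  qed
qed

end
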